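(* Let $\varphi_3:\mathbb{N}\to\mathbb{N}$ be the function defined as follows. The values $\varphi_3(0),\varphi_3(1),\dots,\varphi_3(29)$ are, in order, $$3,1,4,0,2,7,6,5,9,8,\ 11,10,13,12,19,18,21,20,15,14,\ 17,16,27,26,29,28,23,22,25,24.$$ (1) If either $30\le x<56$ or $7\cdot 2^{2n}\le x<7\cdot 2^{2n+1}$ for some integer $n\ge 2$, then $\varphi_3(x)=x\oplus 1$. (2) If $7\cdot 2^{2n-1}\le x<7\cdot 2^{2n}$ for some integer $n\ge2$, then $\varphi_3(x)=x\oplus 3$. Then, for all nonnegative integers $a,b$, the Halve Nim position $a^1b^13^1$ is a $\mathcal{P}$-position if and only if $b=\varphi_3(a)$. Furthermore, for $a,b\ge 30$, $a^1b^13^1$ is a $\mathcal{P}$-position if and only if $$a\oplus b=2+(-1)^{\lfloor\log_2(a/7)\rfloor+1}.$$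
   Context: $\mathbb{N}$ is the set of nonnegative integers and $\oplus$ denotes bitwise XOR. Halve Nim is a two-player game played on finitely many piles of coins; players alternate moves and a player who cannot move loses. A move is one of: (i) choose one pile and remove at least one coin from it; (ii) halve the game: simultaneously replace every pile of $m$ coins by a pile of $\lfloor m/2\rfloor$ coins. When there are no coins left, no move is available (halving requires at least one coin to be present). A position is a $\mathcal{P}$-position if the player who is not about to move has a winning strategy (equivalently, every move from it leads to an $\mathcal{N}$-position), and an $\mathcal{N}$-position if the player about to move has a winning strategy. $a^1b^1c^1$ denotes the position with three piles of sizes $a$, $b$, $c$ (a pile of size $0$ is an empty pile); in particular $a^1b^13^1$ has piles of sizes $a$, $b$, $3$. *)

theory Defs
  imports Complex_Main "HOL-Library.Multiset"
begin

unbundle bit_operations_syntax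

text \<open>
  A position is the multiset of its pile sizes. Empty piles may occur as elements \<open>0\<close>;
  no move can change them, so they do not affect the play.
\<close>

type_synonym position = "nat multiset"

inductive halve_nim_move :: "position \<Rightarrow> position \<Rightarrow> bool" where
  remove: "k < m \<Longrightarrow> halve_nim_move (add_mset m G) (add_mset k G)"
| halve: "\<exists>m \<in># G. 0 < m \<Longrightarrow> halve_nim_move G (image_mset (\<lambda>m. m div 2) G)"

text \<open>
  The least fixed point expresses that the respective player can force a win in finitely many
  moves. Since every play is finite, each position is of exactly one of the two
  kinds (see \<open>N_position_iff_not_P_position\<close>).
\<close>

inductive P_position :: "position \<Rightarrow> bool" and N_position :: "position \<Rightarrow> bool" where
  P_positionI: "(\<And>G'. halve_nim_move G G' \<Longrightarrow> N_position G') \<Longrightarrow> P_position G"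
| N_positionI: "halve_nim_move G G' \<Longrightarrow> P_position G' \<Longrightarrow> N_position G"

lemma sum_mset_halve_le: "(\<Sum>m\<in>#G. m div 2) \<le> sum_mset (G :: nat multiset)"
  by (induction G) auto

lemma halve_nim_move_decreases:
  assumes "halve_nim_move G G'"
  shows "sum_mset G' < sum_mset G"
  using assms
proof cases
  case (remove k m H)
  then show ?thesis by simp
next
  case halve
  then obtain m H where "0 < m" and "G = add_mset m H"
    by (meson multi_member_split)
  moreover have "m div 2 < m"
    using \<open>0 < m\<close> by simp
  ultimately show ?thesis
    using halve sum_mset_halve_le[of H] by simp
qed

lemma N_position_iff_not_P_position: "N_position G \<longleftrightarrow> \<not> P_position G"
proof (induction "sum_mset G" arbitrary: G rule: less_induct)
  case less
  then have "N_position G' \<longleftrightarrow> \<not> P_position G'" if "halve_nim_move G G'" for G'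
    using halve_nim_move_decreases that by blast
  then show ?case
    by (metis N_position.simps P_position.simps)
qed

definition phi3_table :: "nat list" where
  "phi3_table =
    [3, 1, 4, 0, 2, 7, 6, 5, 9, 8, 11, 10, 13, 12, 19, 18, 21, 20, 15, 14,
     17, 16, 27, 26, 29, 28, 23, 22, 25, 24]"

text \<open>
  The cases are exhaustive (see \<open>phi3_cases_exhaustive\<close>), so the final \<open>undefined\<close> is never reached.
\<close>

definition phi3 :: "nat \<Rightarrow> nat" where
  "phi3 x =
    (if x < 30 then phi3_table ! x
     else if x < 56 \<or> (\<exists>n::nat. 2 \<le> n \<and> 7 * 2 ^ (2 * n) \<le> x \<and> x < 7 * 2 ^ (2 * n + 1))
       then x XOR 1
     else if \<exists>n::nat. 2 \<le> n \<and> 7 * 2 ^ (2 * n - 1) \<le> x \<and> x < 7 * 2 ^ (2 * n)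
       then x XOR 3
     else undefined)"

lemma phi3_cases_exhaustive:
  fixes x :: nat
  assumes "56 \<le> x"
  shows "(\<exists>n::nat. 2 \<le> n \<and> 7 * 2 ^ (2 * n) \<le> x \<and> x < 7 * 2 ^ (2 * n + 1)) \<or>
         (\<exists>n::nat. 2 \<le> n \<and> 7 * 2 ^ (2 * n - 1) \<le> x \<and> x < 7 * 2 ^ (2 * n))"
proof -
  have "1 \<le> x div 7"
    using assms by simp
  then obtain k :: nat where k: "2 ^ k \<le> x div 7" "x div 7 < 2 ^ (k + 1)"
    using ex_power_ivl1[of 2 "x div 7"] by auto
  have lo: "7 * 2 ^ k \<le> x" and hi: "x < 7 * 2 ^ (k + 1)"
    using k by (auto simp: less_eq_div_iff_mult_less_eq div_less_iff_less_mult mult.commute)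
  have "(2::nat) ^ 3 < 2 ^ (k + 1)"
    using hi assms by simp
  then have "3 \<le> k"
    using power_less_imp_less_exp[of "2::nat" 3 "k + 1"] by linarith
  show ?thesis
  proof (cases "even k")
    case True
    then obtain n where "k = 2 * n" by (elim evenE)
    then show ?thesis
      using lo hi \<open>3 \<le> k\<close> by (intro disjI1 exI[of _ n]) auto
  next
    case False
    then obtain n where "k = 2 * n + 1" by (elim oddE)
    then show ?thesis
      using lo hi \<open>3 \<le> k\<close> by (intro disjI2 exI[of _ "n + 1"]) auto
  qed
qed

end

theory Submission
  imports Defs
begin

text \<open>
  Halving \<open>a\<^sup>1b\<^sup>13\<^sup>1\<close> leads to a third pile of size 1, and then 0, so the positions with third pile
  \<open>c \<le> 3\<close> are closed under moves and are treated together: \<open>a\<^sup>1b\<^sup>1c\<^sup>1\<close> is a P-position iff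
  \<open>b = phi c a\<close>. For large \<open>a\<close>, with \<open>7 \<cdot> 2\<^sup>k \<le> a < 7 \<cdot> 2\<^sup>k\<^sup>+\<^sup>1\<close>, the condition reads
  \<open>a \<oplus> b \<oplus> c = 2\<close> if \<open>k\<close> is even and \<open>a \<oplus> b \<oplus> c = 0\<close> if \<open>k\<close> is odd. Halving flips the parity of
  \<open>k\<close>, whence it never leads from one such position to another. Since \<open>phi c\<close> preserves the blocks
  \<open>{4q, \<dots>, 4q + 3}\<close> of large numbers, all that is left to check about the existence of winning moves concerns
  residues modulo 4, and finitely many small \<open>a\<close>.
\<close>

section \<open>The candidate function and its finite verification\<close>

text \<open>
  For \<open>a \<ge> 7\<close> this is the parity of \<open>\<lfloor>log 2 (a / 7)\<rfloor>\<close>, in a form where halving is a rewrite step.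
\<close>

fun even_level :: "nat \<Rightarrow> bool" where
  "even_level a = (if a < 14 then True else \<not> even_level (a div 2))"

declare even_level.simps [simp del]

text \<open>
  Entry \<open>c\<close> lists the values of \<open>phi c\<close> before it becomes regular; they were found by computing the
  P-positions recursively.
\<close>

definition small_phi :: "nat list list" where
  "small_phi =
    [[0, 2, 1, 3, 4, 5, 8, 9, 6, 7, 12, 13, 10, 11],
     [2, 3, 0, 1, 5, 4, 9, 8, 7, 6, 13, 12, 11, 10],
     [1, 0, 2, 4, 3, 6, 5, 7, 8, 9, 10, 11, 12, 13, 18, 19, 20, 21, 14, 15,
      16, 17, 26, 27, 28, 29, 22, 23, 24, 25],
     phi3_table]"

definition twist :: "bool \<Rightarrow> nat" where
  "twist e = (if e then 2 else 0)"

definition phi :: "nat \<Rightarrow> nat \<Rightarrow> nat" where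
  "phi c a = (let t = small_phi ! c in
     if a < length t then t ! a else a XOR (c XOR twist (even_level a)))"

lemma less_4_cases: "c < 4 \<Longrightarrow> c = 0 \<or> c = 1 \<or> c = 2 \<or> c = (3::nat)"
  by linarith

text \<open>The bound 32 exceeds all table lengths and is a multiple of 4. Invariance of the numbers
  below 32 under \<open>phi c\<close> keeps small and large arguments apart.\<close>

lemma phi_small_closed: "\<forall>c\<in>set [0..<4]. \<forall>a\<in>set [0..<32].
    phi c a < 32 \<and> phi c (phi c a) = a \<and> (\<forall>k\<in>set [0..<c]. phi k a \<noteq> phi c a) \<and>
    (0 < a + phi c a + c \<longrightarrow> phi c a div 2 \<noteq> phi (c div 2) (a div 2))"
  by code_simp

text \<open>
  Filtering the range of \<open>b\<close>, rather than writing an implication, keeps \<open>code_simp\<close> from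
  evaluating the conclusion for the many \<open>b\<close> that violate the premise.
\<close>

lemma phi_small_reach: "\<forall>c\<in>set [0..<4]. \<forall>a\<in>set [0..<32].
    \<forall>b\<in>set (filter (\<lambda>b. a < phi c b) [0..<phi c a]).
      (\<exists>k\<in>set [0..<c]. b = phi k a) \<or>
      0 < a + b + c \<and> b div 2 = phi (c div 2) (a div 2)"
  by code_simp

section \<open>Regular range: XOR on blocks of four\<close>

lemma phi_regular:
  assumes "c < 4" "32 \<le> a \<or> 14 \<le> a \<and> c < 2"
  shows "phi c a = a XOR (c XOR twist (even_level a))"
  using assms less_4_cases[OF assms(1)]
  by (auto simp: phi_def small_phi_def phi3_table_def)

lemma xor_less_power2:
  fixes r s :: nat
  assumes "r < 2 ^ n" "s < 2 ^ n"
  shows "r XOR s < 2 ^ n"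
  by (metis assms take_bit_nat_eq_self take_bit_nat_less_exp take_bit_xor)

text \<open>The sums are free of carries, so XOR acts on high and low binary digits
  separately.\<close>

lemma xor_add_power2_mult:
  fixes p q r s :: nat
  assumes "r < 2 ^ n" "s < 2 ^ n"
  shows "(2 ^ n * p + r) XOR (2 ^ n * q + s) = 2 ^ n * (p XOR q) + (r XOR s)"
proof -
  let ?x = "(2 ^ n * p + r) XOR (2 ^ n * q + s)"
  have "drop_bit n ?x = p XOR q"
    using assms by (simp add: drop_bit_xor) (simp add: drop_bit_eq_div)
  moreover have "take_bit n ?x = r XOR s"
    using assms by (simp add: take_bit_xor) (simp add: take_bit_eq_mod)
  ultimately show ?thesis
    by (metis drop_bit_eq_div mult_div_mod_eq take_bit_eq_mod)
qed

lemma xor_left_cancel: "(a :: nat) XOR x = a XOR y \<longleftrightarrow> x = y"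
  by (metis xor.assoc xor.left_neutral xor_self_eq)

lemma xor_div_2: "(a XOR b) div 2 = (a div 2) XOR (b div 2)" for a b :: nat
  using drop_bit_xor[of 1 a b] by (simp add: drop_bit_eq_div)

lemma xor_less_4_div_4: "g < 4 \<Longrightarrow> (a XOR g) div 4 = a div 4" for a g :: nat
  using drop_bit_xor[of 2 a g] by (simp add: drop_bit_eq_div)

lemma even_level_half: "14 \<le> a \<Longrightarrow> even_level a \<longleftrightarrow> \<not> even_level (a div 2)"
  by (subst even_level.simps) simp

text \<open>Two halvings flip the parity twice; hence it is constant on blocks of four from 28
  on.\<close>

lemma even_level_div_4: "28 \<le> a \<Longrightarrow> even_level (a div 4) = even_level a"
  using even_level_half[of a] even_level_half[of "a div 2"] by (simp add: div_mult2_eq[symmetric])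

lemma twist_less_4: "twist e < 4"
  by (simp add: twist_def)

lemma shift_less_4: "c < 4 \<Longrightarrow> c XOR twist e < 4"
  using xor_less_power2[of c 2] twist_less_4 by simp

lemma phi_div_4:
  assumes "c < 4" "32 \<le> a"
  shows "phi c a div 4 = a div 4"
  using assms by (simp add: phi_regular xor_less_4_div_4 shift_less_4)

text \<open>\<open>phi c\<close> stays in the block of \<open>a\<close>, hence keeps its level, so
  the same mask is applied twice and cancels.\<close>

lemma phi_involution_large:
  assumes "c < 4" "32 \<le> a"
  shows "phi c (phi c a) = a"
proof -
  have block: "phi c a div 4 = a div 4"
    by (rule phi_div_4[OF assms])
  have "8 \<le> phi c a div 4"
    using div_le_mono[OF assms(2), of 4] by (simp add: block)
  then have "32 \<le> phi c a"
    using less_eq_div_iff_mult_less_eq[of 4 8 "phi c a"] by simp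
  then have "28 \<le> phi c a" "28 \<le> a"
    using assms(2) by linarith+
  then have level: "even_level (phi c a) = even_level a"
    using even_level_div_4[of a] even_level_div_4[of "phi c a"] block by metis
  have "phi c (phi c a) = phi c a XOR (c XOR twist (even_level a))"
    unfolding level[symmetric]
    using assms(1) \<open>32 \<le> phi c a\<close> by (intro phi_regular disjI1)
  also have "\<dots> = a"
    unfolding phi_regular[OF assms(1) disjI1[OF assms(2)]]
    by (simp only: xor.assoc[of a] xor_self_eq xor.right_neutral)
  finally show ?thesis .
qed

text \<open>The halves of \<open>c\<close> cancel; what remains compares
  \<open>twist e div 2\<close> with \<open>twist (\<not> e)\<close>, that is, 1 with 0 or 0 with
  2.\<close>

lemma phi_div_2_large:
  assumes "c < 4" "32 \<le> a"
  shows "phi c a div 2 \<noteq> phi (c div 2) (a div 2)"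
proof -
  have "phi c a div 2 = (a div 2) XOR ((c div 2) XOR (twist (even_level a) div 2))"
    using assms by (simp add: phi_regular xor_div_2)
  \<comment> \<open>Halving leaves \<open>a\<close> at least 16 and \<open>c\<close> below 2, the
    second alternative of \<open>phi_regular\<close>.\<close>
  moreover have "phi (c div 2) (a div 2) =
      (a div 2) XOR ((c div 2) XOR twist (\<not> even_level a))"
    using assms even_level_half[of a] by (subst phi_regular) auto
  ultimately show ?thesis
    by (auto simp: xor_left_cancel twist_def)
qed

text \<open>The residue form of \<open>phi_reach_large\<close>. Halving is offered only when
  \<open>e\<close> holds: the halved level is then odd, so its twist is 0.\<close>

lemma phi_reach_block: "\<forall>c\<in>set [0..<4]. \<forall>r\<in>set [0..<4]. \<forall>s\<in>set [0..<4]. \<forall>e\<in>{True, False}.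
    s < r XOR (c XOR twist e) \<longrightarrow> r < s XOR (c XOR twist e) \<longrightarrow>
      (\<exists>k\<in>set [0..<c]. s = r XOR (k XOR twist e)) \<or>
      e \<and> s div 2 = (r div 2) XOR (c div 2)"
  by code_simp

lemma phi_reach_large:
  assumes "c < 4" "32 \<le> a" "32 \<le> b" "b < phi c a" "a < phi c b"
  shows "(\<exists>k<c. b = phi k a) \<or> b div 2 = phi (c div 2) (a div 2)"
proof -
  define q r s e where "q = a div 4" and "r = a mod 4" and "s = b mod 4" and "e = even_level a"
  \<comment> \<open>As \<open>phi c\<close> preserves blocks, the two inequalities force
    \<open>a\<close> and \<open>b\<close> into the same one.\<close>
  have "b div 4 \<le> phi c a div 4" "a div 4 \<le> phi c b div 4"
    using assms by (auto intro: div_le_mono)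
  then have q: "a div 4 = b div 4"
    using assms by (simp add: phi_div_4)
  have a: "a = 4 * q + r" and b: "b = 4 * q + s" and rs: "r < 4" "s < 4"
    using mult_div_mod_eq[of 4 a] mult_div_mod_eq[of 4 b] q by (simp_all add: q_def r_def s_def)
  have e: "even_level b = e"
    using q assms even_level_div_4[of a] even_level_div_4[of b] by (simp add: e_def)
  have block: "phi k (4 * q + u) = 4 * q + (u XOR (k XOR twist e))"
    if "k < 4" "u < 4" "even_level (4 * q + u) = e" "32 \<le> 4 * q + u" for k u
    using xor_add_power2_mult[of u 2 "k XOR twist e" q 0] that shift_less_4[of k e]
    by (simp add: phi_regular)
  have ea: "even_level (4 * q + r) = e" and eb: "even_level (4 * q + s) = e"
    using e a b e_def by auto
  have 1: "s < r XOR (c XOR twist e)" "r < s XOR (c XOR twist e)"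
    using block[of c r] block[of c s] assms(1-5) rs ea eb by (simp_all add: a b)
  have "c \<in> set [0..<4]" "r \<in> set [0..<4]" "s \<in> set [0..<4]" "e \<in> {True, False}"
    using assms rs by auto
  from phi_reach_block[rule_format, OF this 1] consider
    k where "k < c" "s = r XOR (k XOR twist e)" | "e" "s div 2 = (r div 2) XOR (c div 2)"
    by auto
  then show ?thesis
  proof cases
    case 1
    then have "b = phi k a"
      using block[of k r] assms rs ea by (simp add: a b)
    then show ?thesis using 1 by blast
  next
    case 2
    have "b div 2 = 2 * q + s div 2" "a div 2 = 2 * q + r div 2"
      by (simp_all add: a b)
    moreover have "phi (c div 2) (a div 2) = (a div 2) XOR (c div 2)"
      using assms even_level_half[of a] \<open>e\<close> by (subst phi_regular) (auto simp: twist_def e_def)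
    ultimately show ?thesis
      using xor_add_power2_mult[of "r div 2" 1 "c div 2" q 0] rs assms 2 by simp
  qed
qed

section \<open>The recursion satisfied by \<open>phi\<close>\<close>

lemma phi_involution: "c < 4 \<Longrightarrow> phi c (phi c a) = a"
  using phi_small_closed phi_involution_large by (cases "a < 32") auto

lemma phi_neq:
  assumes "k < c" "c < 4"
  shows "phi k a \<noteq> phi c a"
proof (cases "a < 32")
  case True
  then show ?thesis
    using phi_small_closed assms by auto
next
  case False
  have "(k XOR t = c XOR t) = (k = c)" for t :: nat
    by (metis xor.commute xor_left_cancel)
  then show ?thesis
    using False assms by (simp add: phi_regular xor_left_cancel)
qed

lemma phi_div_2:
  assumes "c < 4" "0 < a + phi c a + c"
  shows "phi c a div 2 \<noteq> phi (c div 2) (a div 2)"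
  using phi_small_closed phi_div_2_large assms by (cases "a < 32") auto

text \<open>The premises rule out winning moves on the first two piles; the third pile or halving
  must then supply one.\<close>

lemma phi_reach:
  assumes "c < 4" "b < phi c a" "a < phi c b"
  shows "(\<exists>k<c. b = phi k a) \<or> 0 < a + b + c \<and> b div 2 = phi (c div 2) (a div 2)"
proof (cases "a < 32")
  case True
  then have "c \<in> set [0..<4]" "a \<in> set [0..<32]"
    "b \<in> set (filter (\<lambda>b. a < phi c b) [0..<phi c a])"
    using assms by auto
  from phi_small_reach[rule_format, OF this] show ?thesis
    by auto
next
  case False
  have "32 \<le> b"
  proof (rule ccontr)
    assume "\<not> 32 \<le> b"
    then have "phi c b < 32"
      using phi_small_closed assms by auto
    then show False
      using False assms by simp
  qed
  then show ?thesis
    using phi_reach_large[of c a b] False assms by auto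
qed

text \<open>This is the recursion \<open>P_position_3_iff\<close> with \<open>b = phi c a\<close> in
  place of being a P-position.\<close>

lemma eq_phi_iff:
  assumes "c < 4"
  shows "b = phi c a \<longleftrightarrow>
    (\<forall>k<a. b \<noteq> phi c k) \<and> (\<forall>k<b. k \<noteq> phi c a) \<and> (\<forall>k<c. b \<noteq> phi k a) \<and>
    (0 < a + b + c \<longrightarrow> b div 2 \<noteq> phi (c div 2) (a div 2))"
  (is "?L \<longleftrightarrow> ?R")
proof
  assume ?L
  then show ?R
    using assms phi_involution[OF assms] phi_neq[of _ c a] phi_div_2[of c a]
    by (metis nat_neq_iff)
next
  assume R: ?R
  show ?L
  proof (rule ccontr)
    assume "b \<noteq> phi c a"
    \<comment> \<open>The second conjunct excludes \<open>phi c a < b\<close>; the first, at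
      \<open>k = phi c b\<close>, excludes \<open>phi c b < a\<close>.\<close>
    then have "b < phi c a" "a < phi c b"
      using R phi_involution[OF assms] by (metis nat_neq_iff)+
    then show False
      using phi_reach[OF assms] R by blast
  qed
qed

section \<open>Halve Nim on three piles\<close>

lemma halve_nim_move_3:
  "halve_nim_move {#a, b, c#} G \<longleftrightarrow>
    (\<exists>k<a. G = {#k, b, c#}) \<or> (\<exists>k<b. G = {#a, k, c#}) \<or> (\<exists>k<c. G = {#a, b, k#}) \<or>
    0 < a + b + c \<and> G = {#a div 2, b div 2, c div 2#}"
  (is "?L \<longleftrightarrow> ?R")
proof
  assume ?L
  then show ?R
  proof cases
    case (remove k m H)
    then have "m = a \<and> H = {#b, c#} \<or> m = b \<and> H = {#a, c#} \<or> m = c \<and> H = {#a, b#}"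
      by (auto simp: add_eq_conv_ex add_mset_eq_single)
    then show ?thesis
      using remove by (auto simp: add_mset_commute)
  next
    case halve
    then show ?thesis by auto
  qed
next
  have rotate: "{#x, y, z#} = {#z, x, y#}" for x y z :: nat
    by (simp add: add_mset_commute)
  assume ?R
  then consider k where "k < a" "G = {#k, b, c#}" | k where "k < b" "G = {#a, k, c#}"
    | k where "k < c" "G = {#a, b, k#}" | "0 < a + b + c" "G = {#a div 2, b div 2, c div 2#}"
    by blast
  then show ?L
  proof cases
    case 1
    then show ?thesis by (simp add: halve_nim_move.remove)
  next
    case 2
    then show ?thesis
      using halve_nim_move.remove[of k b "{#a, c#}"] by (simp add: add_mset_commute)
  next
    case 3
    then show ?thesis
      using halve_nim_move.remove[of k c "{#a, b#}"] by (simp add: rotate[of a b])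
  next
    case 4
    then show ?thesis
      using halve_nim_move.halve[of "{#a, b, c#}"] by auto
  qed
qed

lemma P_position_iff: "P_position G \<longleftrightarrow> (\<forall>G'. halve_nim_move G G' \<longrightarrow> \<not> P_position G')"
  by (metis N_position_iff_not_P_position P_position.simps)

lemma P_position_3_iff:
  "P_position {#a, b, c#} \<longleftrightarrow>
    (\<forall>k<a. \<not> P_position {#k, b, c#}) \<and> (\<forall>k<b. \<not> P_position {#a, k, c#}) \<and>
    (\<forall>k<c. \<not> P_position {#a, b, k#}) \<and>
    (0 < a + b + c \<longrightarrow> \<not> P_position {#a div 2, b div 2, c div 2#})"
  by (subst P_position_iff) (unfold halve_nim_move_3, blast)

text \<open>Both sides satisfy the same recursion on the total number of coins. All
  \<open>c < 4\<close> are treated at once because moves may lower the third pile.\<close>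

lemma P_position_iff_phi: "c < 4 \<Longrightarrow> P_position {#a, b, c#} \<longleftrightarrow> b = phi c a"
proof (induction "a + b + c" arbitrary: a b c rule: less_induct)
  case less
  have "P_position {#k, b, c#} \<longleftrightarrow> b = phi c k" if "k < a" for k
    using less that by simp
  moreover have "P_position {#a, k, c#} \<longleftrightarrow> k = phi c a" if "k < b" for k
    using less that by simp
  moreover have "P_position {#a, b, k#} \<longleftrightarrow> b = phi k a" if "k < c" for k
    using less that by simp
  moreover have "P_position {#a div 2, b div 2, c div 2#} \<longleftrightarrow> b div 2 = phi (c div 2) (a div 2)"
    if "0 < a + b + c"
    using that less.prems by (intro less.hyps) linarith+
  ultimately show ?case
    by (subst P_position_3_iff, subst eq_phi_iff[OF less.prems]) auto
qed

section \<open>Translation into \<open>phi3\<close> and the logarithm\<close>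

lemma even_level_iff:
  "7 * 2 ^ k \<le> x \<Longrightarrow> x < 7 * 2 ^ Suc k \<Longrightarrow> even_level x \<longleftrightarrow> even k"
proof (induction k arbitrary: x)
  case 0
  then show ?case by (simp add: even_level.simps)
next
  case (Suc k)
  have "7 * 2 ^ k \<le> x div 2" "x div 2 < 7 * 2 ^ Suc k"
    using Suc.prems by auto
  moreover have "(1::nat) \<le> 2 ^ k"
    by simp
  then have "14 \<le> x"
    using Suc.prems(1) unfolding power_Suc by linarith
  ultimately show ?case
    using Suc.IH even_level_half by simp
qed

text \<open>The mask is \<open>3 XOR 2 = 1\<close> or \<open>3 XOR 0 = 3\<close>.\<close>

lemma phi_3_large:
  assumes "30 \<le> a"
  shows "phi 3 a = a XOR (if even_level a then 1 else 3)"
  using assms by (simp add: phi_def small_phi_def phi3_table_def twist_def)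

lemma phi_3_eq_phi3: "phi 3 a = phi3 a"
proof -
  consider "a < 30" | "30 \<le> a" "a < 56" | "56 \<le> a"
    by linarith
  then show ?thesis
  proof cases
    case 1
    then show ?thesis
      by (simp add: phi_def phi3_def small_phi_def phi3_table_def)
  next
    case 2
    \<comment> \<open>Here \<open>a div 2\<close> lies in the odd level from 14 to 27.\<close>
    then have "even_level a"
      using even_level_half[of a] even_level_iff[of 1 "a div 2"] by simp
    then show ?thesis
      using 2 by (simp add: phi_3_large phi3_def)
  next
    case 3
    have even: "even_level a" if "7 * 2 ^ (2 * n) \<le> a" "a < 7 * 2 ^ (2 * n + 1)" for n
      using even_level_iff[of "2 * n" a] that by simp
    have odd: "\<not> even_level a"
      if "2 \<le> n" "7 * 2 ^ (2 * n - 1) \<le> a" "a < 7 * 2 ^ (2 * n)" for n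
      using even_level_iff[of "2 * n - 1" a] that by simp
    show ?thesis
      using phi3_cases_exhaustive[OF 3] even odd 3 unfolding phi3_def
      by (auto simp: phi_3_large)
  qed
qed

lemma floor_log_level:
  assumes "30 \<le> (a::nat)"
  shows "2 + (-1) powi (\<lfloor>log 2 (real a / 7)\<rfloor> + 1) = (if even_level a then 1 else 3 :: real)"
proof -
  \<comment> \<open>Powers of 2 being integers, \<open>a div 7\<close> and the real quotient lie
    between the same two.\<close>
  have "1 \<le> a div 7"
    using assms by simp
  then obtain k where k: "2 ^ k \<le> a div 7" "a div 7 < 2 ^ (k + 1)"
    using ex_power_ivl1[of 2 "a div 7"] by auto
  have lo: "7 * 2 ^ k \<le> a" and hi: "a < 7 * 2 ^ Suc k"
    using k by (auto simp: less_eq_div_iff_mult_less_eq div_less_iff_less_mult mult.commute)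
  have "real (7 * 2 ^ k) \<le> real a" "real a < real (7 * 2 ^ Suc k)"
    using lo hi by (simp_all only: of_nat_le_iff of_nat_less_iff)
  then have "\<lfloor>log 2 (real a / 7)\<rfloor> = int k"
    using assms by (subst floor_log_eq_powr_iff) (simp_all add: powr_realpow powr_add field_simps)
  then show ?thesis
    using even_level_iff[OF lo hi] by (simp add: power_int_add)
qed

theorem theorem21:
  shows "(\<forall>a b :: nat. P_position {#a, b, 3#} \<longleftrightarrow> b = phi3 a) \<and>
    (\<forall>a b :: nat. 30 \<le> a \<longrightarrow> 30 \<le> b \<longrightarrow>
      (P_position {#a, b, 3#} \<longleftrightarrow>
        real (a XOR b) = 2 + (-1) powi (\<lfloor>log 2 (real a / 7)\<rfloor> + 1)))"
proof (intro conjI allI impI)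
  fix a b :: nat
  show "P_position {#a, b, 3#} \<longleftrightarrow> b = phi3 a"
    by (simp add: P_position_iff_phi phi_3_eq_phi3)
next
  fix a b :: nat
  assume "30 \<le> a"
  define d :: nat where "d = (if even_level a then 1 else 3)"
  have "P_position {#a, b, 3#} \<longleftrightarrow> b = a XOR d"
    using \<open>30 \<le> a\<close> by (simp add: P_position_iff_phi phi_3_large d_def)
  also have "\<dots> \<longleftrightarrow> a XOR b = d"
    by (metis xor.assoc xor.left_neutral xor_self_eq)
  also have "\<dots> \<longleftrightarrow> real (a XOR b) = real d"
    by (simp only: of_nat_eq_iff)
  also have "real d = 2 + (-1) powi (\<lfloor>log 2 (real a / 7)\<rfloor> + 1)"
    using floor_log_level[OF \<open>30 \<le> a\<close>] by (simp add: d_def)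
  finally show "P_position {#a, b, 3#} \<longleftrightarrow>
      real (a XOR b) = 2 + (-1) powi (\<lfloor>log 2 (real a / 7)\<rfloor> + 1)" .
qed

end
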